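(* Let $G$ be a group with multiplicative Lie algebra structures $\star_1$ and $\star_2$ satisfying the following conditions for all $x,y,z,w\in G$: (1) $G\star_1G$ and $G\star_2G$ are abelian; (2) $(x\star_1y)(z\star_2w)=(z\star_2w)(x\star_1y)$; (3) $((x\star_1y)\star_2{}^yz)\,((x\star_2y)\star_1{}^yz)\,((y\star_1z)\star_2{}^zx)\,((y\star_2z)\star_1{}^zx)\,((z\star_1x)\star_2{}^xy)\,((z\star_2x)\star_1{}^xy)=1$. Then the binary operation $\star$ on $G$ given by $x\star y=(x\star_1y)(x\star_2y)$ defines a multiplicative Lie algebra structure on $G$.
   Context: Notation: ${}^xy=xyx^{-1}$. A multiplicative Lie algebra structure on a group $G$ is a binary operation $\star$ on $G$ such that for all $x,y,z\in G$: (i) $x\star x=1$; (ii) $x\star(yz)=(x\star y)\,{}^y(x\star z)$; (iii) $(xy)\star z={}^x(y\star z)\,(x\star z)$; (iv) $((x\star y)\star{}^yz)((y\star z)\star{}^zx)((z\star x)\star{}^xy)=1$; (v) ${}^z(x\star y)=({}^zx)\star({}^zy)$. For $i=1,2$, $G\star_iG$ denotes the subgroup of $G$ generated by $\{x\star_iy\mid x,y\in G\}$. *)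

theory Defs
  imports "HOL-Algebra.Generated_Groups"
begin

definition conjugate :: "('a, 'b) monoid_scheme \<Rightarrow> 'a \<Rightarrow> 'a \<Rightarrow> 'a"  (infixr "\<triangleright>\<index>" 75)
  where "x \<triangleright>\<^bsub>G\<^esub> y = x \<otimes>\<^bsub>G\<^esub> y \<otimes>\<^bsub>G\<^esub> inv\<^bsub>G\<^esub> x"

locale multiplicative_lie_algebra = group G for G (structure) +
  fixes star :: "'a \<Rightarrow> 'a \<Rightarrow> 'a"  (infixl "\<star>" 80)
  assumes star_closed: "\<lbrakk>x \<in> carrier G; y \<in> carrier G\<rbrakk> \<Longrightarrow> x \<star> y \<in> carrier G"
    and star_self: "x \<in> carrier G \<Longrightarrow> x \<star> x = \<one>"
    and star_mult_right: "\<lbrakk>x \<in> carrier G; y \<in> carrier G; z \<in> carrier G\<rbrakk>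
      \<Longrightarrow> x \<star> (y \<otimes> z) = (x \<star> y) \<otimes> (y \<triangleright> (x \<star> z))"
    and star_mult_left: "\<lbrakk>x \<in> carrier G; y \<in> carrier G; z \<in> carrier G\<rbrakk>
      \<Longrightarrow> (x \<otimes> y) \<star> z = (x \<triangleright> (y \<star> z)) \<otimes> (x \<star> z)"
    and star_jacobi: "\<lbrakk>x \<in> carrier G; y \<in> carrier G; z \<in> carrier G\<rbrakk>
      \<Longrightarrow> ((x \<star> y) \<star> (y \<triangleright> z)) \<otimes> ((y \<star> z) \<star> (z \<triangleright> x)) \<otimes> ((z \<star> x) \<star> (x \<triangleright> y)) = \<one>"
    and star_conjugate: "\<lbrakk>x \<in> carrier G; y \<in> carrier G; z \<in> carrier G\<rbrakk>
      \<Longrightarrow> z \<triangleright> (x \<star> y) = (z \<triangleright> x) \<star> (z \<triangleright> y)"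

definition star_subgroup :: "('a, 'b) monoid_scheme \<Rightarrow> ('a \<Rightarrow> 'a \<Rightarrow> 'a) \<Rightarrow> 'a set"
  where "star_subgroup G star = generate G {star x y | x y. x \<in> carrier G \<and> y \<in> carrier G}"

end

theory Submission
  imports Defs
begin

text \<open>
  Let \<open>A\<close> be the subgroup generated by all values of both operations.
  The values of each operation commute with one another and with those of the other operation, so
  \<open>A\<close> is abelian (\<open>generate_commute\<close>); and the conjugation axiom makes the generating set
  invariant under conjugation by all of \<open>G\<close>.

  Each axiom for the pointwise product is a product of the corresponding axioms for the two
  operations, once the factors, which all lie in \<open>A\<close>, are reordered. Only the Jacobi identity
  needs more, because there the operations are applied to each other's values. Let \<open>a = x \<star>\<^sub>1 y\<close>,
  \<open>b = x \<star>\<^sub>2 y\<close> and \<open>w = y \<triangleright> z\<close>. On commuting elements the left distributive law loses its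
  conjugation (\<open>star_mult_left_commuting\<close>), so \<open>(x \<star> y) \<star> w\<close> is the product of
  \<open>a \<star>\<^sub>1 w\<close>, \<open>a \<star>\<^sub>2 w\<close>, \<open>b \<star>\<^sub>1 w\<close> and \<open>b \<star>\<^sub>2 w\<close>.
  Over the cyclic permutations of \<open>x\<close>, \<open>y\<close>, \<open>z\<close> this gives twelve commuting factors: those of
  the form \<open>a \<star>\<^sub>1 w\<close> multiply to \<open>\<one>\<close> by the Jacobi identity of the first operation, those of the
  form \<open>b \<star>\<^sub>2 w\<close> by that of the second, and the six mixed ones by the compatibility condition.
\<close>

context group
begin

lemma conjugate_closed:
  "\<lbrakk>x \<in> carrier G; y \<in> carrier G\<rbrakk> \<Longrightarrow> x \<triangleright> y \<in> carrier G"
  by (simp add: conjugate_def)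

lemma conjugate_mult:
  "\<lbrakk>x \<in> carrier G; y \<in> carrier G; z \<in> carrier G\<rbrakk> \<Longrightarrow> x \<triangleright> (y \<otimes> z) = (x \<triangleright> y) \<otimes> (x \<triangleright> z)"
  by (simp add: conjugate_def m_assoc) (simp add: m_assoc[symmetric])

lemma conjugate_commuting:
  "\<lbrakk>x \<in> carrier G; y \<in> carrier G; x \<otimes> y = y \<otimes> x\<rbrakk> \<Longrightarrow> x \<triangleright> y = y"
  by (simp add: conjugate_def m_assoc)

lemma centralizer_subgroup:
  assumes "S \<subseteq> carrier G"
  shows "subgroup {c \<in> carrier G. \<forall>s\<in>S. c \<otimes> s = s \<otimes> c} G"
proof (rule subgroupI)
  fix a assume a: "a \<in> {c \<in> carrier G. \<forall>s\<in>S. c \<otimes> s = s \<otimes> c}"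
  have "inv a \<otimes> s = s \<otimes> inv a" if "s \<in> S" for s
  proof -
    have s: "s \<in> carrier G" using that assms by blast
    have "inv a \<otimes> s = inv a \<otimes> (s \<otimes> a) \<otimes> inv a"
      using a s by (simp add: m_assoc)
    also have "s \<otimes> a = a \<otimes> s" using a that by simp
    also have "inv a \<otimes> (a \<otimes> s) \<otimes> inv a = s \<otimes> inv a"
      using a s by (simp add: m_assoc[symmetric])
    finally show ?thesis .
  qed
  then show "inv a \<in> {c \<in> carrier G. \<forall>s\<in>S. c \<otimes> s = s \<otimes> c}" using a by simp
next
  fix a b
  assume a: "a \<in> {c \<in> carrier G. \<forall>s\<in>S. c \<otimes> s = s \<otimes> c}"
    and b: "b \<in> {c \<in> carrier G. \<forall>s\<in>S. c \<otimes> s = s \<otimes> c}"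
  have "(a \<otimes> b) \<otimes> s = s \<otimes> (a \<otimes> b)" if "s \<in> S" for s
  proof -
    have s: "s \<in> carrier G" using that assms by blast
    have "(a \<otimes> b) \<otimes> s = a \<otimes> (s \<otimes> b)" using a b s that by (simp add: m_assoc)
    also have "\<dots> = (s \<otimes> a) \<otimes> b" using a b s that by (simp add: m_assoc[symmetric])
    finally show ?thesis using a b s by (simp add: m_assoc)
  qed
  then show "a \<otimes> b \<in> {c \<in> carrier G. \<forall>s\<in>S. c \<otimes> s = s \<otimes> c}" using a b by simp
next
  show "{c \<in> carrier G. \<forall>s\<in>S. c \<otimes> s = s \<otimes> c} \<noteq> {}"
    using assms by (auto intro!: exI[of _ \<one>])
qed blast

text \<open>
  The centralizer of \<open>S\<close> contains \<open>S\<close>, hence \<open>generate G S\<close>; so \<open>S\<close> lies in the centralizer of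
  \<open>generate G S\<close>, which therefore contains \<open>generate G S\<close> too.
\<close>

lemma generate_commute:
  assumes S: "S \<subseteq> carrier G"
    and commute: "\<And>s t. \<lbrakk>s \<in> S; t \<in> S\<rbrakk> \<Longrightarrow> s \<otimes> t = t \<otimes> s"
    and "a \<in> generate G S" "b \<in> generate G S"
  shows "a \<otimes> b = b \<otimes> a"
proof -
  have "generate G S \<subseteq> {c \<in> carrier G. \<forall>s\<in>S. c \<otimes> s = s \<otimes> c}"
    by (rule generate_subgroup_incl[OF _ centralizer_subgroup[OF S]]) (use S commute in auto)
  then have "generate G S \<subseteq> {c \<in> carrier G. \<forall>s\<in>generate G S. c \<otimes> s = s \<otimes> c}"
    by (intro generate_subgroup_incl[OF _ centralizer_subgroup[OF generate_incl[OF S]]])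
       (use S in force)
  then show ?thesis using assms by blast
qed

end

lemma star_in_star_subgroup:
  "\<lbrakk>x \<in> carrier G; y \<in> carrier G\<rbrakk> \<Longrightarrow> star x y \<in> star_subgroup G star"
  unfolding star_subgroup_def by (rule generate.incl) blast

text \<open>
  The conjugation in the left distributive law acts on the value \<open>y \<star> z\<close>, so it disappears as
  soon as \<open>x\<close> commutes with that value.
\<close>

lemma (in multiplicative_lie_algebra) star_mult_left_commuting:
  assumes "x \<in> carrier G" "y \<in> carrier G" "z \<in> carrier G"
    and "x \<otimes> (y \<star> z) = (y \<star> z) \<otimes> x"
  shows "(x \<otimes> y) \<star> z = (y \<star> z) \<otimes> (x \<star> z)"
  using assms by (simp add: star_mult_left conjugate_commuting star_closed)

theorem theorem3p5:
  fixes G :: "('a, 'b) monoid_scheme" (structure)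
    and star1 :: "'a \<Rightarrow> 'a \<Rightarrow> 'a" (infixl "\<star>\<^sub>1" 80)
    and star2 :: "'a \<Rightarrow> 'a \<Rightarrow> 'a" (infixl "\<star>\<^sub>2" 80)
  assumes "group G"
    and "multiplicative_lie_algebra G (\<star>\<^sub>1)"
    and "multiplicative_lie_algebra G (\<star>\<^sub>2)"
    and "comm_group (G\<lparr>carrier := star_subgroup G (\<star>\<^sub>1)\<rparr>)"
    and "comm_group (G\<lparr>carrier := star_subgroup G (\<star>\<^sub>2)\<rparr>)"
    and "\<And>x y z w. \<lbrakk>x \<in> carrier G; y \<in> carrier G; z \<in> carrier G; w \<in> carrier G\<rbrakk>
      \<Longrightarrow> (x \<star>\<^sub>1 y) \<otimes> (z \<star>\<^sub>2 w) = (z \<star>\<^sub>2 w) \<otimes> (x \<star>\<^sub>1 y)"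
    and "\<And>x y z. \<lbrakk>x \<in> carrier G; y \<in> carrier G; z \<in> carrier G\<rbrakk>
      \<Longrightarrow> ((x \<star>\<^sub>1 y) \<star>\<^sub>2 (y \<triangleright> z)) \<otimes> ((x \<star>\<^sub>2 y) \<star>\<^sub>1 (y \<triangleright> z))
        \<otimes> ((y \<star>\<^sub>1 z) \<star>\<^sub>2 (z \<triangleright> x)) \<otimes> ((y \<star>\<^sub>2 z) \<star>\<^sub>1 (z \<triangleright> x))
        \<otimes> ((z \<star>\<^sub>1 x) \<star>\<^sub>2 (x \<triangleright> y)) \<otimes> ((z \<star>\<^sub>2 x) \<star>\<^sub>1 (x \<triangleright> y)) = \<one>"
  shows "multiplicative_lie_algebra G (\<lambda>x y. (x \<star>\<^sub>1 y) \<otimes> (x \<star>\<^sub>2 y))"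
proof -
  interpret group G by fact
  interpret L1: multiplicative_lie_algebra G "(\<star>\<^sub>1)" by fact
  interpret L2: multiplicative_lie_algebra G "(\<star>\<^sub>2)" by fact
  define S where
    "S = {x \<star>\<^sub>1 y | x y. x \<in> carrier G \<and> y \<in> carrier G} \<union>
         {x \<star>\<^sub>2 y | x y. x \<in> carrier G \<and> y \<in> carrier G}"
  define A where "A = generate G S"
  have S_carrier: "S \<subseteq> carrier G"
    by (auto simp: S_def L1.star_closed L2.star_closed)
  have commute1: "(x \<star>\<^sub>1 y) \<otimes> (z \<star>\<^sub>1 w) = (z \<star>\<^sub>1 w) \<otimes> (x \<star>\<^sub>1 y)"
    if "x \<in> carrier G" "y \<in> carrier G" "z \<in> carrier G" "w \<in> carrier G" for x y z w
    using comm_groupE(4)[OF assms(4), of "x \<star>\<^sub>1 y" "z \<star>\<^sub>1 w"] that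
    by (simp add: star_in_star_subgroup)
  have commute2: "(x \<star>\<^sub>2 y) \<otimes> (z \<star>\<^sub>2 w) = (z \<star>\<^sub>2 w) \<otimes> (x \<star>\<^sub>2 y)"
    if "x \<in> carrier G" "y \<in> carrier G" "z \<in> carrier G" "w \<in> carrier G" for x y z w
    using comm_groupE(4)[OF assms(5), of "x \<star>\<^sub>2 y" "z \<star>\<^sub>2 w"] that
    by (simp add: star_in_star_subgroup)
  have S_commute: "s \<otimes> t = t \<otimes> s" if "s \<in> S" "t \<in> S" for s t
    using that by (auto simp: S_def commute1 commute2 assms(6))
  have A_comm: "a \<otimes> b = b \<otimes> a" if "a \<in> A" "b \<in> A" for a b
    using generate_commute[OF S_carrier S_commute] that by (simp add: A_def)
  have A_carrier: "a \<in> carrier G" if "a \<in> A" for a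
    using generate_incl[OF S_carrier] that by (auto simp: A_def)
  have A_closed: "a \<otimes> b \<in> A" if "a \<in> A" "b \<in> A" for a b
    using that by (simp add: A_def generate.eng)
  have A_assoc: "(a \<otimes> b) \<otimes> c = a \<otimes> (b \<otimes> c)" if "a \<in> A" "b \<in> A" "c \<in> A" for a b c
    using that by (simp add: A_carrier m_assoc)
  have A_lcomm: "a \<otimes> (b \<otimes> c) = b \<otimes> (a \<otimes> c)" if "a \<in> A" "b \<in> A" "c \<in> A" for a b c
    using that A_comm[of a b] by (simp add: A_assoc[symmetric])
  note A_ac = A_closed A_assoc A_comm A_lcomm
  have star1_A: "x \<star>\<^sub>1 y \<in> A" and star2_A: "x \<star>\<^sub>2 y \<in> A"
    if "x \<in> carrier G" "y \<in> carrier G" for x y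
    using that by (auto simp: A_def S_def intro!: generate.incl)
  \<comment> \<open>A conjugate of a generator of \<open>A\<close> is again a generator.\<close>
  have conj1_A: "z \<triangleright> (x \<star>\<^sub>1 y) \<in> A" and conj2_A: "z \<triangleright> (x \<star>\<^sub>2 y) \<in> A"
    if "x \<in> carrier G" "y \<in> carrier G" "z \<in> carrier G" for x y z
    using that
    by (simp_all add: L1.star_conjugate L2.star_conjugate star1_A star2_A conjugate_closed)
  note closed = L1.star_closed L2.star_closed conjugate_closed
  show ?thesis
  proof (unfold_locales, goal_cases)
    case (1 x y)
    then show ?case by (simp add: closed)
  next
    case (2 x)
    then show ?case by (simp add: L1.star_self L2.star_self)
  next
    case (3 x y z)
    then have A: "x \<star>\<^sub>1 y \<in> A" "x \<star>\<^sub>2 y \<in> A" "y \<triangleright> (x \<star>\<^sub>1 z) \<in> A" "y \<triangleright> (x \<star>\<^sub>2 z) \<in> A"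
      by (simp_all add: star1_A star2_A conj1_A conj2_A)
    from 3 show ?case
      by (simp add: L1.star_mult_right L2.star_mult_right conjugate_mult closed)
         (simp add: A_ac A)
  next
    case (4 x y z)
    then have A: "x \<star>\<^sub>1 z \<in> A" "x \<star>\<^sub>2 z \<in> A" "x \<triangleright> (y \<star>\<^sub>1 z) \<in> A" "x \<triangleright> (y \<star>\<^sub>2 z) \<in> A"
      by (simp_all add: star1_A star2_A conj1_A conj2_A)
    from 4 show ?case
      by (simp add: L1.star_mult_left L2.star_mult_left conjugate_mult closed)
         (simp add: A_ac A)
  next
    case (5 x y z)
    \<comment> \<open>The two mixed factors are kept together, so that \<open>regroup\<close> splits the product of three
        such terms into the three identities that make it trivial.\<close>
    have expand: "((x \<star>\<^sub>1 y) \<otimes> (x \<star>\<^sub>2 y)) \<star>\<^sub>1 w \<otimes> ((x \<star>\<^sub>1 y) \<otimes> (x \<star>\<^sub>2 y)) \<star>\<^sub>2 w =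
        ((x \<star>\<^sub>1 y) \<star>\<^sub>1 w) \<otimes> (((x \<star>\<^sub>1 y) \<star>\<^sub>2 w) \<otimes> ((x \<star>\<^sub>2 y) \<star>\<^sub>1 w)) \<otimes> ((x \<star>\<^sub>2 y) \<star>\<^sub>2 w)"
      if "x \<in> carrier G" "y \<in> carrier G" "w \<in> carrier G" for x y w
    proof -
      have "((x \<star>\<^sub>1 y) \<otimes> (x \<star>\<^sub>2 y)) \<star>\<^sub>1 w = ((x \<star>\<^sub>2 y) \<star>\<^sub>1 w) \<otimes> ((x \<star>\<^sub>1 y) \<star>\<^sub>1 w)"
        using that by (intro L1.star_mult_left_commuting A_comm star1_A star2_A closed)
      moreover
      have "((x \<star>\<^sub>1 y) \<otimes> (x \<star>\<^sub>2 y)) \<star>\<^sub>2 w = ((x \<star>\<^sub>2 y) \<star>\<^sub>2 w) \<otimes> ((x \<star>\<^sub>1 y) \<star>\<^sub>2 w)"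
        using that by (intro L2.star_mult_left_commuting A_comm star1_A star2_A closed)
      ultimately show ?thesis
        using that by (simp add: A_ac star1_A star2_A closed)
    qed
    have regroup: "(a \<otimes> m \<otimes> b) \<otimes> (a' \<otimes> m' \<otimes> b') \<otimes> (a'' \<otimes> m'' \<otimes> b'') =
        (a \<otimes> a' \<otimes> a'') \<otimes> (m \<otimes> m' \<otimes> m'') \<otimes> (b \<otimes> b' \<otimes> b'')"
      if "a \<in> A" "a' \<in> A" "a'' \<in> A" "m \<in> A" "m' \<in> A" "m'' \<in> A" "b \<in> A" "b' \<in> A" "b'' \<in> A"
      for a a' a'' m m' m'' b b' b''
      using that by (simp add: A_ac)
    have mixed: "((x \<star>\<^sub>1 y) \<star>\<^sub>2 (y \<triangleright> z) \<otimes> (x \<star>\<^sub>2 y) \<star>\<^sub>1 (y \<triangleright> z))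
        \<otimes> ((y \<star>\<^sub>1 z) \<star>\<^sub>2 (z \<triangleright> x) \<otimes> (y \<star>\<^sub>2 z) \<star>\<^sub>1 (z \<triangleright> x))
        \<otimes> ((z \<star>\<^sub>1 x) \<star>\<^sub>2 (x \<triangleright> y) \<otimes> (z \<star>\<^sub>2 x) \<star>\<^sub>1 (x \<triangleright> y)) = \<one>"
      using 5 assms(7)[OF 5] by (simp add: m_assoc closed)
    show ?case
      using 5
      by (simp add: expand closed, subst regroup)
         (simp_all add: mixed L1.star_jacobi L2.star_jacobi A_closed star1_A star2_A closed)
  next
    case (6 x y z)
    then show ?case
      by (simp add: conjugate_mult L1.star_conjugate L2.star_conjugate closed)
  qed
qed

end
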